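(* There is an algorithm which, given a sandpile instance $S(G,\sigma)$ where $G$ is the path on $n$ vertices, determines whether $S$ terminates and, if it does, computes the terminal configuration of $S$, in $O(n)$ time using $O(n)$ memory.
   Context: A sandpile instance $S(G,\sigma)$ consists of an undirected, unweighted, simple graph $G$ with $n$ vertices and a configuration $\sigma\in\mathbb{N}^{V(G)}$ ($\sigma_v$ = number of chips on $v$). A vertex $v$ is full if $\sigma_v\ge\deg(v)$. Firing a full vertex $v$ decreases $\sigma_v$ by $\deg(v)$ and increases $\sigma_w$ by $1$ for every neighbor $w$ of $v$. A configuration is terminal if no vertex is full. The instance terminates if some finite sequence of firings of full vertices reaches a terminal configuration (which is then unique, independent of firing order); otherwise it is recurrent. The computational model is the word-RAM with $\Theta(\log n)$-bit words. *)

theory Defs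
  imports Complex_Main "HOL-Library.Landau_Symbols"
begin

section \<open>Sandpiles on finite simple graphs\<close>

record 'v ugraph =
  verts :: "'v set"
  edges :: "'v set set"

definition simple_graph :: "'v ugraph \<Rightarrow> bool" where
  "simple_graph G \<longleftrightarrow> finite (verts G) \<and>
     (\<forall>e\<in>edges G. \<exists>u\<in>verts G. \<exists>v\<in>verts G. u \<noteq> v \<and> e = {u, v})"

definition neighbors :: "'v ugraph \<Rightarrow> 'v \<Rightarrow> 'v set" where
  "neighbors G v = {u. {v, u} \<in> edges G}"

definition degree :: "'v ugraph \<Rightarrow> 'v \<Rightarrow> nat" where
  "degree G v = card (neighbors G v)"

text \<open>A configuration is a function on the whole vertex type; only its values on
  \<open>verts G\<close> matter, and firing never changes the other ones.\<close>

type_synonym 'v configuration = "'v \<Rightarrow> nat"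

definition full :: "'v ugraph \<Rightarrow> 'v configuration \<Rightarrow> 'v \<Rightarrow> bool" where
  "full G \<sigma> v \<longleftrightarrow> v \<in> verts G \<and> degree G v \<le> \<sigma> v"

definition fire :: "'v ugraph \<Rightarrow> 'v \<Rightarrow> 'v configuration \<Rightarrow> 'v configuration" where
  "fire G v \<sigma> = (\<lambda>u. if u = v then \<sigma> u - degree G v
                      else if u \<in> neighbors G v then \<sigma> u + 1
                      else \<sigma> u)"

definition firing :: "'v ugraph \<Rightarrow> 'v configuration \<Rightarrow> 'v configuration \<Rightarrow> bool" where
  "firing G \<sigma> \<tau> \<longleftrightarrow> (\<exists>v. full G \<sigma> v \<and> \<tau> = fire G v \<sigma>)"

definition terminal :: "'v ugraph \<Rightarrow> 'v configuration \<Rightarrow> bool" where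
  "terminal G \<sigma> \<longleftrightarrow> (\<forall>v\<in>verts G. \<not> full G \<sigma> v)"

definition terminates_in :: "'v ugraph \<Rightarrow> 'v configuration \<Rightarrow> 'v configuration \<Rightarrow> bool" where
  "terminates_in G \<sigma> \<tau> \<longleftrightarrow> (firing G)\<^sup>*\<^sup>* \<sigma> \<tau> \<and> terminal G \<tau>"

definition sandpile_terminates :: "'v ugraph \<Rightarrow> 'v configuration \<Rightarrow> bool" where
  "sandpile_terminates G \<sigma> \<longleftrightarrow> (\<exists>\<tau>. terminates_in G \<sigma> \<tau>)"

definition path_graph :: "nat \<Rightarrow> nat ugraph" where
  "path_graph n = \<lparr>verts = {..<n}, edges = {{i, Suc i} | i. Suc i < n}\<rparr>"

lemma simple_graph_path_graph: "simple_graph (path_graph n)"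
  unfolding simple_graph_def path_graph_def
  by (clarsimp, metis Suc_lessD lessThan_iff n_not_Suc_n)

lemma neighbors_path_graph:
  "neighbors (path_graph n) v = {u. u < n \<and> v < n \<and> (u = Suc v \<or> v = Suc u)}"
  unfolding neighbors_def path_graph_def by (auto simp: doubleton_eq_iff)


section \<open>The word RAM\<close>

text \<open>The word size \<open>w\<close> is a parameter of the execution, not of the program, so words
  are natural numbers below \<open>2 ^ w\<close> rather than elements of a type of fixed-length words. A
  program is a finite list of instructions; it names finitely many registers, each holding one
  word, and addresses the main memory only through registers.\<close>

datatype word_op =
  Add | Sub | Mul | Div | Mod | And | Or | Xor | ShiftL | ShiftR

fun word_op_sem :: "nat \<Rightarrow> word_op \<Rightarrow> nat \<Rightarrow> nat \<Rightarrow> nat" where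
  "word_op_sem w Add a b = (a + b) mod 2 ^ w"
| "word_op_sem w Sub a b = (a + (2 ^ w - b)) mod 2 ^ w"
| "word_op_sem w Mul a b = (a * b) mod 2 ^ w"
| "word_op_sem w Div a b = a div b"
| "word_op_sem w Mod a b = a mod b"
| "word_op_sem w And a b = Bit_Operations.and a b"
| "word_op_sem w Or a b = Bit_Operations.or a b"
| "word_op_sem w Xor a b = Bit_Operations.xor a b"
| "word_op_sem w ShiftL a b = push_bit b a mod 2 ^ w"
| "word_op_sem w ShiftR a b = drop_bit b a"

datatype instr =
    LoadConst nat nat
  | Op word_op nat nat nat
  | Load nat nat
  | Store nat nat
  | Jump nat
  | JumpLess nat nat nat
  | Halt

text \<open>A machine state consists of the program counter, the registers and the main memory,
  whose size is the length of the list.\<close>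

type_synonym ram_state = "nat \<times> (nat \<Rightarrow> nat) \<times> nat list"

text \<open>Each instruction takes one unit of time. \<open>None\<close> means that there is no next state:
  the machine has halted, or it has faulted by leaving the program or by accessing an address
  outside its memory.\<close>

definition ram_step :: "nat \<Rightarrow> instr list \<Rightarrow> ram_state \<Rightarrow> ram_state option" where
  "ram_step w P s = (case s of (pc, R, M) \<Rightarrow>
     if pc < length P then
       (case P ! pc of
          LoadConst r k \<Rightarrow> Some (Suc pc, R(r := k mod 2 ^ w), M)
        | Op f r a b \<Rightarrow> Some (Suc pc, R(r := word_op_sem w f (R a) (R b)), M)
        | Load r a \<Rightarrow> if R a < length M then Some (Suc pc, R(r := M ! R a), M) else None
        | Store a r \<Rightarrow> if R a < length M then Some (Suc pc, R, M[R a := R r]) else None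
        | Jump l \<Rightarrow> Some (l, R, M)
        | JumpLess a b l \<Rightarrow> Some (if R a < R b then l else Suc pc, R, M)
        | Halt \<Rightarrow> None)
     else None)"

definition ram_halted :: "instr list \<Rightarrow> ram_state \<Rightarrow> bool" where
  "ram_halted P s \<longleftrightarrow> fst s < length P \<and> P ! fst s = Halt"

text \<open>With word size \<open>w\<close> and a main memory of \<open>S\<close> words, which initially holds the
  input followed by zeros, \<open>P\<close> halts after at most \<open>T\<close> steps with memory contents \<open>M\<close>.
  As accesses beyond the memory are faults, \<open>S\<close> bounds the memory used, including that for
  input and output.\<close>

definition ram_computes ::
    "nat \<Rightarrow> nat \<Rightarrow> nat \<Rightarrow> instr list \<Rightarrow> nat list \<Rightarrow> nat list \<Rightarrow> bool" where
  "ram_computes w S T P input M \<longleftrightarrow> length input \<le> S \<and>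
     (\<exists>t\<le>T. \<exists>pc R.
        ((\<lambda>s s'. ram_step w P s = Some s') ^^ t)
          (0, \<lambda>_. 0, input @ replicate (S - length input) 0) (pc, R, M) \<and>
        ram_halted P (pc, R, M))"


section \<open>Input and output for sandpiles on paths\<close>

definition path_input :: "nat \<Rightarrow> nat configuration \<Rightarrow> nat list" where
  "path_input n \<sigma> = n # map \<sigma> [0..<n]"

text \<open>Word 0 of the output says whether the instance terminates. If it does, the following
  \<open>n\<close> words are the terminal configuration.\<close>

definition correct_path_output :: "nat \<Rightarrow> nat configuration \<Rightarrow> nat list \<Rightarrow> bool" where
  "correct_path_output n \<sigma> M \<longleftrightarrow>
     (if sandpile_terminates (path_graph n) \<sigma>
      then \<exists>\<tau>. terminates_in (path_graph n) \<sigma> \<tau> \<and>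
               take (Suc n) M = 1 # map \<tau> [0..<n]
      else take 1 M = [0])"

end

theory Submission
  imports Defs
begin

text \<open>Firing preserves the number of chips, and a terminal configuration on the path with
  \<open>n\<close> vertices has at most \<open>n - 2\<close> of them, so an instance with more chips is recurrent.
  Otherwise the path is stabilised from left to right, treating the next vertex as a sink. The
  stabilised part is described by its holes, that is, its vertices without a chip; vertex \<open>0\<close>
  always is one. An excess chip on the right end of this part moves the rightmost hole one
  step to the right and exports one chip to the sink; a hole that is already at the right end
  absorbs the chip, and if vertex \<open>0\<close> is the only hole, the chip is exported and nothing
  else changes. So a stack of holes supports the processing of many excess chips at once, in
  amortised constant time per vertex: each vertex pushes one hole, and each round of the inner
  loop but the last pops one. Finally a chip on the last vertex is sent back until it has
  filled the rightmost hole, so \<open>e\<close> chips there pop \<open>e\<close> holes; as there are at most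
  \<open>n - 2\<close> chips, the hole at vertex \<open>0\<close> survives.\<close>

section \<open>Firings at the ends and in the interior of a path\<close>

abbreviation reachable :: "nat \<Rightarrow> nat configuration \<Rightarrow> nat configuration \<Rightarrow> bool" where
  "reachable n \<equiv> (firing (path_graph n))\<^sup>*\<^sup>*"

lemma verts_path_graph [simp]: "verts (path_graph n) = {..<n}"
  by (simp add: path_graph_def)

lemma neighbors_path_graph_interior:
  assumes "0 < v" "Suc v < n"
  shows "neighbors (path_graph n) v = {v - 1, Suc v}"
  using assms by (auto simp: neighbors_path_graph)

lemma neighbors_path_graph_first:
  assumes "1 < n"
  shows "neighbors (path_graph n) 0 = {1}"
  using assms by (auto simp: neighbors_path_graph)

lemma neighbors_path_graph_last:
  assumes "0 < v" "Suc v = n"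
  shows "neighbors (path_graph n) v = {v - 1}"
  using assms by (auto simp: neighbors_path_graph)

text \<open>The chips that \<open>v\<close> loses are added on the left of the equation. So no
  truncated subtraction occurs, and the equation can be checked by cases on the position of
  \<open>u\<close>.\<close>

lemma firing_interior:
  assumes "0 < v" "Suc v < n" "2 \<le> f v"
    and "\<And>u. g u + 2 * of_bool (u = v) = f u + of_bool (Suc u = v) + of_bool (u = Suc v)"
  shows "firing (path_graph n) f g"
proof -
  have "g = fire (path_graph n) v f"
  proof
    fix u
    show "g u = fire (path_graph n) v f u"
      using assms(4)[of u] assms(1,3) neighbors_path_graph_interior[OF assms(1,2)]
      by (cases "u = v"; cases "Suc u = v"; cases "u = Suc v") (auto simp: fire_def degree_def)
  qed
  moreover have "full (path_graph n) f v"
    using assms(1-3) neighbors_path_graph_interior[OF assms(1,2)]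
    by (simp add: full_def degree_def)
  ultimately show ?thesis
    unfolding firing_def by blast
qed

lemma firing_first:
  assumes "1 < n" "1 \<le> f 0"
    and "\<And>u. g u + of_bool (u = 0) = f u + of_bool (u = 1)"
  shows "firing (path_graph n) f g"
proof -
  have "g = fire (path_graph n) 0 f"
  proof
    fix u
    show "g u = fire (path_graph n) 0 f u"
      using assms(3)[of u] assms(2) neighbors_path_graph_first[OF assms(1)]
      by (cases "u = 0"; cases "u = 1") (auto simp: fire_def degree_def)
  qed
  moreover have "full (path_graph n) f 0"
    using assms(1,2) neighbors_path_graph_first[OF assms(1)]
    by (simp add: full_def degree_def)
  ultimately show ?thesis
    unfolding firing_def by blast
qed

lemma firing_last:
  assumes "0 < v" "Suc v = n" "1 \<le> f v"
    and "\<And>u. g u + of_bool (u = v) = f u + of_bool (Suc u = v)"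
  shows "firing (path_graph n) f g"
proof -
  have "g = fire (path_graph n) v f"
  proof
    fix u
    show "g u = fire (path_graph n) v f u"
      using assms(4)[of u] assms(1,3) neighbors_path_graph_last[OF assms(1,2)]
      by (cases "u = v"; cases "Suc u = v") (auto simp: fire_def degree_def)
  qed
  moreover have "full (path_graph n) f v"
    using assms(1-3) neighbors_path_graph_last[OF assms(1,2)]
    by (simp add: full_def degree_def)
  ultimately show ?thesis
    unfolding firing_def by blast
qed

section \<open>Conservation of chips and recurrence\<close>

lemma sum_fire:
  assumes "simple_graph G" "full G f v"
  shows "sum (fire G v f) (verts G) = sum f (verts G)"
proof -
  have fin: "finite (verts G)" and v: "v \<in> verts G" and deg: "card (neighbors G v) \<le> f v"
    using assms by (auto simp: simple_graph_def full_def degree_def)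
  have sub: "neighbors G v \<subseteq> verts G" and irr: "v \<notin> neighbors G v"
    using assms(1) by (fastforce simp: simple_graph_def neighbors_def doubleton_eq_iff)+
  have "fire G v f u + (if u = v then card (neighbors G v) else 0)
      = f u + (if u \<in> neighbors G v then 1 else 0)" for u
    using deg irr by (auto simp: fire_def degree_def)
  then have "(\<Sum>u\<in>verts G. fire G v f u + (if u = v then card (neighbors G v) else 0))
      = (\<Sum>u\<in>verts G. f u + (if u \<in> neighbors G v then 1 else 0))"
    by simp
  moreover have "(\<Sum>u\<in>verts G. if u \<in> neighbors G v then 1 else 0) = card (neighbors G v)"
    using fin sub by (simp add: sum.If_cases Int_absorb1)
  ultimately show ?thesis
    using fin v by (simp add: sum.distrib)
qed

lemma sum_firings:
  assumes "simple_graph G" "(firing G)\<^sup>*\<^sup>* f g"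
  shows "sum g (verts G) = sum f (verts G)"
  using assms(2) by induction (auto simp: firing_def sum_fire[OF assms(1)])

text \<open>A vertex that is not full has fewer chips than neighbors: none at an end, at most one
  inside.\<close>

lemma sum_le_if_terminal_path:
  assumes "1 \<le> n" "terminal (path_graph n) f"
  shows "sum f {..<n} + 2 \<le> n"
proof -
  have small: "f v < card (neighbors (path_graph n) v)" if "v < n" for v
    using assms(2) that by (simp add: terminal_def full_def degree_def not_le)
  \<comment> \<open>A lone vertex has degree 0 and is always full.\<close>
  have n2: "1 < n"
  proof (rule ccontr)
    assume "\<not> 1 < n"
    then have "neighbors (path_graph n) 0 = {}"
      by (auto simp: neighbors_path_graph)
    then show False
      using small[of 0] assms(1) by simp
  qed
  \<comment> \<open>A dummy chip on each end makes the bound uniform; these two chips give the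
    summand 2.\<close>
  have "f v + of_bool (v = 0) + of_bool (v = n - 1) \<le> 1" if v: "v < n" for v
  proof -
    consider "v = 0" | "Suc v = n" "0 < v" | "0 < v" "Suc v < n"
      using v by fastforce
    then show ?thesis
      using small[OF v] n2
      by cases (auto simp: neighbors_path_graph_first neighbors_path_graph_last
          neighbors_path_graph_interior)
  qed
  then have "(\<Sum>v<n. f v + of_bool (v = 0) + of_bool (v = n - 1)) \<le> (\<Sum>v<n. 1)"
    by (intro sum_mono) auto
  then show ?thesis
    using n2 by (simp add: sum.distrib of_bool_def)
qed

lemma not_terminates_path:
  assumes "1 \<le> n" "n < sum \<sigma> {..<n} + 2"
  shows "\<not> sandpile_terminates (path_graph n) \<sigma>"
proof
  assume "sandpile_terminates (path_graph n) \<sigma>"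
  then obtain \<tau> where "reachable n \<sigma> \<tau>" "terminal (path_graph n) \<tau>"
    by (auto simp: sandpile_terminates_def terminates_in_def)
  then show False
    using sum_firings[OF simple_graph_path_graph, of n \<sigma> \<tau>] sum_le_if_terminal_path[of n \<tau>] assms
    by simp
qed

text \<open>Fire \<open>i\<close>, \<open>i - 1\<close> and so on down to \<open>z + 1\<close>.\<close>

lemma reachable_wave:
  assumes "z < i" "Suc i < n" "2 \<le> f i" "\<And>v. z < v \<Longrightarrow> v < i \<Longrightarrow> f v = 1"
    and "\<And>v. g v + of_bool (v = Suc z) + of_bool (v = i)
            = f v + of_bool (v = z) + of_bool (v = Suc i)"
  shows "reachable n f g"
  using assms
proof (induction "i - z" arbitrary: z g)
  case 0
  then show ?case by simp
next
  case (Suc k)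
  show ?case
  proof (cases "Suc z = i")
    case True
    have "firing (path_graph n) f g"
    proof (rule firing_interior)
      show "g u + 2 * of_bool (u = i) = f u + of_bool (Suc u = i) + of_bool (u = Suc i)" for u
        using Suc.prems(5)[of u] True by (auto split: if_splits)
    qed (use Suc.prems(1-3) in auto)
    then show ?thesis by simp
  next
    case False
    with Suc.prems have less: "Suc z < i" by simp
    \<comment> \<open>\<open>h\<close> is the state before the last firing: the wave has come down
      to \<open>z + 2\<close> and left two chips on \<open>z + 1\<close>.\<close>
    define h where "h = (\<lambda>v. f v + of_bool (v = Suc z) + of_bool (v = Suc i)
      - (of_bool (v = Suc (Suc z)) + of_bool (v = i)) :: nat)"
    have ge1: "f v \<ge> of_bool (v = Suc (Suc z)) + of_bool (v = i)" for v
      using Suc.prems(3) Suc.prems(4)[of v] less by (auto simp: of_bool_def)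
    have h: "h v + of_bool (v = Suc (Suc z)) + of_bool (v = i)
        = f v + of_bool (v = Suc z) + of_bool (v = Suc i)" for v
      using ge1[of v] unfolding h_def by linarith
    have "reachable n f h"
      using Suc.hyps(2) less Suc.prems(2-4) h by (intro Suc.hyps(1)[where z = "Suc z"]) auto
    moreover have "firing (path_graph n) h g"
    proof (rule firing_interior[of "Suc z"])
      show "g u + 2 * of_bool (u = Suc z) = h u + of_bool (Suc u = Suc z) + of_bool (u = Suc (Suc z))"
        for u
        using Suc.prems(5)[of u] h[of u] by simp
      show "2 \<le> h (Suc z)"
        using h[of "Suc z"] Suc.prems(4)[of "Suc z"] less by simp
    qed (use less Suc.prems(2) in auto)
    ultimately show ?thesis by simp
  qed
qed

section \<open>Stabilising a path from left to right\<close>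

text \<open>The vertices below \<open>i\<close> have been processed: they carry no chip on \<open>Z\<close> and one
  chip elsewhere, up to \<open>e\<close> excess chips on \<open>i - 1\<close>; \<open>c\<close> chips have been exported to \<open>i\<close>.\<close>

definition pile :: "nat configuration \<Rightarrow> nat \<Rightarrow> nat set \<Rightarrow> nat \<Rightarrow> nat \<Rightarrow> nat configuration" where
  "pile \<sigma> i Z e c v = (if v < i then of_bool (v \<notin> Z) else \<sigma> v)
     + (if v = i then c else if Suc v = i then e else 0)"

lemma pile_0: "pile \<sigma> 0 {} 0 0 = \<sigma>"
  by (auto simp: pile_def fun_eq_iff)

text \<open>No firing is involved: vertex \<open>i\<close> joins the processed part as a hole, and
  all chips on it, exported and original, are renamed to excess.\<close>

lemma pile_push: "pile \<sigma> i Z 0 c = pile \<sigma> (Suc i) (insert i Z) (c + \<sigma> i) 0"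
  by (auto simp: pile_def fun_eq_iff)

text \<open>A hole at the right end with one excess chip is just a vertex with one chip.\<close>

lemma pile_pop:
  assumes "i \<in> Z"
  shows "pile \<sigma> (Suc i) Z (Suc e) c = pile \<sigma> (Suc i) (Z - {i}) e c"
  using assms by (auto simp: pile_def fun_eq_iff)

text \<open>With its excess chip, \<open>i\<close> can start a wave down to \<open>z + 1\<close>,
  which fills the rightmost hole \<open>z\<close>, leaves a new one at \<open>z + 1\<close> and
  sends a chip to \<open>i + 1\<close>.\<close>

lemma reachable_slide1:
  assumes "z < i" "Suc i < n" "z \<in> Z" "Z \<inter> {z<..i} = {}"
  shows "reachable n (pile \<sigma> (Suc i) Z (Suc e) c) (pile \<sigma> (Suc i) (insert (Suc z) (Z - {z})) e (Suc c))"
proof (rule reachable_wave[OF assms(1,2)])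
  have nin: "v \<notin> Z" if "z < v" "v \<le> i" for v
    using that assms(4) by auto
  show "2 \<le> pile \<sigma> (Suc i) Z (Suc e) c i"
    using nin[of i] assms by (simp add: pile_def)
  show "pile \<sigma> (Suc i) Z (Suc e) c v = 1" if "z < v" "v < i" for v
    using nin[of v] that by (simp add: pile_def)
  show "pile \<sigma> (Suc i) (insert (Suc z) (Z - {z})) e (Suc c) v + of_bool (v = Suc z) + of_bool (v = i) =
    pile \<sigma> (Suc i) Z (Suc e) c v + of_bool (v = z) + of_bool (v = Suc i)" for v
    using nin[of v] assms by (auto simp: pile_def)
qed

lemma reachable_slide:
  assumes "z + d \<le> i" "Suc i < n" "z \<in> Z" "Z \<inter> {z<..i} = {}"
  shows "reachable n (pile \<sigma> (Suc i) Z (e + d) c)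
    (pile \<sigma> (Suc i) (insert (z + d) (Z - {z})) e (c + d))"
  using assms
proof (induction d arbitrary: e)
  case 0
  then show ?case by (simp add: insert_absorb)
next
  case (Suc d)
  have "reachable n (pile \<sigma> (Suc i) Z (Suc e + d) c)
      (pile \<sigma> (Suc i) (insert (z + d) (Z - {z})) (Suc e) (c + d))"
    using Suc.prems by (intro Suc.IH) auto
  moreover have "insert (Suc (z + d)) (insert (z + d) (Z - {z}) - {z + d}) = insert (z + Suc d) (Z - {z})"
    using Suc.prems by fastforce
  moreover have "reachable n (pile \<sigma> (Suc i) (insert (z + d) (Z - {z})) (Suc e) (c + d))
      (pile \<sigma> (Suc i) (insert (Suc (z + d)) (insert (z + d) (Z - {z}) - {z + d})) e (Suc (c + d)))"
    using Suc.prems by (intro reachable_slide1) auto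
  ultimately show ?case by simp
qed

text \<open>The slide moves the hole from 0 to 1 and makes vertex 0 full; firing vertex 0 then moves
  the hole back.\<close>

lemma reachable_bounce_left1:
  assumes "Suc i < n"
  shows "reachable n (pile \<sigma> (Suc i) {0} (Suc e) c) (pile \<sigma> (Suc i) {0} e (Suc c))"
proof (cases "i = 0")
  case True
  have "firing (path_graph n) (pile \<sigma> (Suc i) {0} (Suc e) c) (pile \<sigma> (Suc i) {0} e (Suc c))"
    by (rule firing_first) (use assms True in \<open>auto simp: pile_def\<close>)
  then show ?thesis by simp
next
  case False
  then have "reachable n (pile \<sigma> (Suc i) {0} (Suc e) c) (pile \<sigma> (Suc i) {1} e (Suc c))"
    using assms reachable_slide1[of 0 i n "{0}" \<sigma> e c] by simp
  moreover have "firing (path_graph n) (pile \<sigma> (Suc i) {1} e (Suc c)) (pile \<sigma> (Suc i) {0} e (Suc c))"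
    by (rule firing_first) (use assms False in \<open>auto simp: pile_def\<close>)
  ultimately show ?thesis by simp
qed

lemma reachable_bounce_left:
  assumes "Suc i < n"
  shows "reachable n (pile \<sigma> (Suc i) {0} e c) (pile \<sigma> (Suc i) {0} 0 (c + e))"
proof (induction e arbitrary: c)
  case 0
  then show ?case by simp
next
  case (Suc e)
  show ?case
    using rtranclp_trans[OF reachable_bounce_left1[OF assms] Suc[of "Suc c"]] by simp
qed

text \<open>Firing the end \<open>i\<close> starts a wave at \<open>i - 1\<close> that moves the
  hole \<open>z\<close> one step to the right and returns the chip to \<open>i\<close>. Once the
  hole is at \<open>i - 1\<close>, firing \<open>i\<close> fills it for good.\<close>

lemma reachable_bounce_right1:
  assumes "z < i" "i \<in> Z" "z \<in> Z" "Z \<inter> {z<..<i} = {}"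
  shows "reachable (Suc i) (pile \<sigma> (Suc i) Z (Suc e) 0) (pile \<sigma> (Suc i) (Z - {z}) e 0)"
  using assms
proof (induction "i - z" arbitrary: z Z)
  case 0
  then show ?case by simp
next
  case (Suc k)
  have nin: "v \<notin> Z" if "z < v" "v < i" for v
    using that Suc.prems by auto
  show ?case
  proof (cases "Suc z = i")
    case True
    have "firing (path_graph (Suc i)) (pile \<sigma> (Suc i) Z (Suc e) 0) (pile \<sigma> (Suc i) (Z - {z}) e 0)"
      by (rule firing_last[of i]) (use Suc.prems True in \<open>auto simp: pile_def\<close>)
    then show ?thesis by simp
  next
    case False
    with Suc.prems obtain j where i: "i = Suc j" and less: "z < j"
      by (cases i) auto
    define Z' where "Z' = insert (Suc z) (Z - {z})"
    define f where "f = pile \<sigma> (Suc i) Z (Suc e) 0"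
    define h where "h = (\<lambda>v. if v = i then e else if v = j then 2 else f v)"
    have "j \<notin> Z"
      using nin[of j] less i by simp
    then have "firing (path_graph (Suc i)) f h"
      by (intro firing_last[of i]) (use Suc.prems(2) i in \<open>auto simp: pile_def f_def h_def\<close>)
    moreover have "reachable (Suc i) h (pile \<sigma> (Suc i) Z' (Suc e) 0)"
    proof (rule reachable_wave[of z j])
      show "h v = 1" if "z < v" "v < j" for v
        using that nin[of v] i by (simp add: h_def f_def pile_def)
      show "pile \<sigma> (Suc i) Z' (Suc e) 0 v + of_bool (v = Suc z) + of_bool (v = j)
          = h v + of_bool (v = z) + of_bool (v = Suc j)" for v
        using less Suc.prems(2,3) nin[of v] i by (auto simp: h_def f_def pile_def Z'_def)
    qed (use less i in \<open>auto simp: h_def\<close>)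
    moreover have "reachable (Suc i) (pile \<sigma> (Suc i) Z' (Suc e) 0) (pile \<sigma> (Suc i) (Z' - {Suc z}) e 0)"
      using Suc.hyps(2) less i Suc.prems by (intro Suc.hyps(1)) (auto simp: Z'_def)
    moreover have "Z' - {Suc z} = Z - {z}"
      using nin[of "Suc z"] less i by (auto simp: Z'_def)
    ultimately show ?thesis
      unfolding f_def by (metis converse_rtranclp_into_rtranclp rtranclp_trans)
  qed
qed

text \<open>A chip on the right end fills the rightmost hole, so \<open>length ys\<close> chips fill the
  \<open>length ys\<close> rightmost ones.\<close>

lemma reachable_bounce_right:
  assumes "sorted_wrt (<) (zs @ ys)" "set (zs @ ys) \<subseteq> {..<i}"
  shows "reachable (Suc i) (pile \<sigma> (Suc i) (insert i (set (zs @ ys))) (length ys) 0)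
    (pile \<sigma> (Suc i) (insert i (set zs)) 0 0)"
  using assms
proof (induction ys rule: rev_induct)
  case Nil
  then show ?case by simp
next
  case (snoc y ys)
  let ?Z = "insert i (set (zs @ ys @ [y]))"
  have "reachable (Suc i) (pile \<sigma> (Suc i) ?Z (Suc (length ys)) 0)
      (pile \<sigma> (Suc i) (?Z - {y}) (length ys) 0)"
    using snoc.prems by (intro reachable_bounce_right1) (force simp: sorted_wrt_append)+
  moreover have "?Z - {y} = insert i (set (zs @ ys))"
    using snoc.prems by (force simp: sorted_wrt_append)
  moreover have "reachable (Suc i) (pile \<sigma> (Suc i) (insert i (set (zs @ ys))) (length ys) 0)
    (pile \<sigma> (Suc i) (insert i (set zs)) 0 0)"
    using snoc by (simp add: sorted_wrt_append)
  ultimately show ?case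
    by (metis (no_types, lifting) length_append_singleton rtranclp_trans)
qed

text \<open>Both ends are holes, and inner vertices have at most one chip.\<close>

lemma terminal_pile:
  assumes "0 < i" "0 \<in> Z" "i \<in> Z"
  shows "terminal (path_graph (Suc i)) (pile \<sigma> (Suc i) Z 0 0)"
  unfolding terminal_def
proof
  fix v
  assume "v \<in> verts (path_graph (Suc i))"
  then consider "v = 0" | "v = i" | "0 < v" "v < i"
    by fastforce
then show "\<not> full (path_graph (Suc i)) (pile \<sigma> (Suc i) Z 0 0) v"
    using assms by cases (auto simp: full_def degree_def pile_def neighbors_path_graph_first
        neighbors_path_graph_last neighbors_path_graph_interior)
qed

section \<open>Running RAM programs\<close>

text \<open>As a function, a run over a fixed number of steps can be evaluated by the
  simplifier.\<close>

primrec ram_run :: "nat \<Rightarrow> instr list \<Rightarrow> nat \<Rightarrow> ram_state \<Rightarrow> ram_state option" where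
  "ram_run w P 0 s = Some s"
| "ram_run w P (Suc k) s = Option.bind (ram_step w P s) (ram_run w P k)"

lemma ram_run_numeral [simp]:
  "ram_run w P (numeral k) s = Option.bind (ram_step w P s) (ram_run w P (pred_numeral k))"
  by (simp add: numeral_eq_Suc)

lemma ram_run_add:
  "ram_run w P (j + k) s = Option.bind (ram_run w P j s) (ram_run w P k)"
proof (induction j arbitrary: s)
  case (Suc j)
  then show ?case by (cases "ram_step w P s") auto
qed simp

lemma relpowp_ram_run:
  "((\<lambda>s s'. ram_step w P s = Some s') ^^ k) s s' \<longleftrightarrow> ram_run w P k s = Some s'"
proof (induction k arbitrary: s)
  case (Suc k)
  show ?case
    by (auto simp: relpowp_Suc_left Suc OO_def bind_eq_Some_conv simp del: relpowp.simps)
qed auto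

definition reaches ::
    "nat \<Rightarrow> instr list \<Rightarrow> nat \<Rightarrow> ram_state \<Rightarrow> (ram_state \<Rightarrow> bool) \<Rightarrow> bool" where
  "reaches w P T s Q \<longleftrightarrow> (\<exists>k\<le>T. \<exists>s'. ram_run w P k s = Some s' \<and> Q s')"

lemma reaches_refl: "Q s \<Longrightarrow> reaches w P T s Q"
  unfolding reaches_def by (intro exI[of _ 0]) auto

lemma reaches_run:
  assumes "ram_run w P k s = Some s'" "reaches w P T s' Q" "k + T \<le> T'"
  shows "reaches w P T' s Q"
proof -
  obtain j s'' where "j \<le> T" "ram_run w P j s' = Some s''" "Q s''"
    using assms(2) by (auto simp: reaches_def)
  then show ?thesis
    using assms(1,3) unfolding reaches_def
    by (intro exI[of _ "k + j"] exI[of _ s'']) (auto simp: ram_run_add)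
qed

lemma reaches_weaken:
  assumes "reaches w P T s Q" "\<And>s'. Q s' \<Longrightarrow> Q' s'"
  shows "reaches w P T s Q'"
  using assms by (auto simp: reaches_def)

lemma ram_computes_reaches:
  assumes "length input \<le> S"
    and "reaches w P T (0, \<lambda>_. 0, input @ replicate (S - length input) 0)
      (\<lambda>s. ram_halted P s \<and> Q (snd (snd s)))"
  shows "\<exists>M. ram_computes w S T P input M \<and> Q M"
  using assms unfolding ram_computes_def reaches_def relpowp_ram_run by auto

lemma word_op_sem_Add: "a + b < 2 ^ w \<Longrightarrow> word_op_sem w Add a b = a + b"
  by simp

lemma word_op_sem_Sub:
  assumes "b \<le> a" "a < 2 ^ w"
  shows "word_op_sem w Sub a b = a - b"
proof -
  have "a + (2 ^ w - b) = 2 ^ w + (a - b)"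
    using assms by simp
  then show ?thesis
    using assms by (simp only: word_op_sem.simps mod_add_self1) simp
qed

text \<open>Addition and subtraction are evaluated only where they do not wrap around, so every run
  needs word bounds.\<close>

lemmas word_op_simps = word_op_sem_Add word_op_sem_Sub word_op_sem.simps(3-)

declare word_op_sem.simps [simp del]

section \<open>The program\<close>

text \<open>Registers: \<open>0\<close> and \<open>1\<close> hold these constants, \<open>2\<close> and \<open>3\<close> hold \<open>n\<close> and
  \<open>n - 1\<close>, \<open>4\<close> and \<open>5\<close> the addresses of the bottom and the top of the stack of holes,
  \<open>6\<close> the address of the current vertex, \<open>7\<close> the number of chips read so far, \<open>8\<close> the
  chips exported to the next vertex, \<open>9\<close> the excess chips on the current vertex, and
  \<open>10\<close>, \<open>11\<close>, \<open>12\<close> a chip count just read, a hole popped, and its distance to the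
  current vertex. Entry points: \<open>5\<close> outer loop, \<open>19\<close> inner loop, \<open>34\<close> right end,
  \<open>37\<close> writing the holes, \<open>43\<close> recurrent instance.\<close>

definition path_program :: "instr list" where
  "path_program = [
     LoadConst 1 1,
     Load 2 0,
     Op Sub 3 2 1,
     Op Add 4 2 1,
     Op Add 5 2 0,
     Op Add 6 6 1,
     Load 10 6,
     JumpLess 10 3 9,
     Jump 43,
     Op Add 7 7 10,
     JumpLess 7 3 12,
     Jump 43,
     Op Add 9 8 10,
     LoadConst 8 0,
     JumpLess 6 2 16,
     Jump 34,
     Store 6 1,
     Op Add 5 5 1,
     Store 5 6,
     JumpLess 4 5 22,
     Op Add 8 8 9,
     Jump 5,
     Load 11 5,
     Op Sub 12 6 11,
     JumpLess 12 9 29,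
     Op Add 11 11 9,
     Op Add 8 8 9,
     Store 5 11,
     Jump 5,
     Op Add 8 8 12,
     Op Sub 9 9 12,
     Op Sub 9 9 1,
     Op Sub 5 5 1,
     Jump 19,
     Store 6 0,
     Op Sub 5 5 9,
     Store 0 1,
     Load 11 5,
     Store 11 0,
     JumpLess 4 5 41,
     Halt,
     Op Sub 5 5 1,
     Jump 37,
     Store 0 0,
     Halt]"

lemma length_path_program: "length path_program = 45"
  by (simp add: path_program_def)

lemma nth_path_program:
  "path_program ! 0 = LoadConst 1 1"
  "path_program ! Suc 0 = Load 2 0"
  "path_program ! 2 = Op Sub 3 2 1"
  "path_program ! 3 = Op Add 4 2 1"
  "path_program ! 4 = Op Add 5 2 0"
  "path_program ! 5 = Op Add 6 6 1"
  "path_program ! 6 = Load 10 6"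
  "path_program ! 7 = JumpLess 10 3 9"
  "path_program ! 8 = Jump 43"
  "path_program ! 9 = Op Add 7 7 10"
  "path_program ! 10 = JumpLess 7 3 12"
  "path_program ! 11 = Jump 43"
  "path_program ! 12 = Op Add 9 8 10"
  "path_program ! 13 = LoadConst 8 0"
  "path_program ! 14 = JumpLess 6 2 16"
  "path_program ! 15 = Jump 34"
  "path_program ! 16 = Store 6 1"
  "path_program ! 17 = Op Add 5 5 1"
  "path_program ! 18 = Store 5 6"
  "path_program ! 19 = JumpLess 4 5 22"
  "path_program ! 20 = Op Add 8 8 9"
  "path_program ! 21 = Jump 5"
  "path_program ! 22 = Load 11 5"
  "path_program ! 23 = Op Sub 12 6 11"
  "path_program ! 24 = JumpLess 12 9 29"
  "path_program ! 25 = Op Add 11 11 9"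
  "path_program ! 26 = Op Add 8 8 9"
  "path_program ! 27 = Store 5 11"
  "path_program ! 28 = Jump 5"
  "path_program ! 29 = Op Add 8 8 12"
  "path_program ! 30 = Op Sub 9 9 12"
  "path_program ! 31 = Op Sub 9 9 1"
  "path_program ! 32 = Op Sub 5 5 1"
  "path_program ! 33 = Jump 19"
  "path_program ! 34 = Store 6 0"
  "path_program ! 35 = Op Sub 5 5 9"
  "path_program ! 36 = Store 0 1"
  "path_program ! 37 = Load 11 5"
  "path_program ! 38 = Store 11 0"
  "path_program ! 39 = JumpLess 4 5 41"
  "path_program ! 40 = Halt"
  "path_program ! 41 = Op Sub 5 5 1"
  "path_program ! 42 = Jump 37"
  "path_program ! 43 = Store 0 0"
  "path_program ! 44 = Halt"
  by (simp_all add: path_program_def)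

lemmas exec = ram_step_def length_path_program nth_path_program word_op_simps

section \<open>Correctness and running time\<close>

text \<open>The order makes the top of the stack the rightmost hole; the bottom is the permanent
  hole at vertex 0.\<close>

definition hole_stack :: "nat \<Rightarrow> nat list \<Rightarrow> bool" where
  "hole_stack i zs \<longleftrightarrow>
     sorted_wrt (<) zs \<and> set zs \<subseteq> {..<i} \<and> (0 < i \<longrightarrow> zs \<noteq> [] \<and> hd zs = 0)"

lemma hole_stack_Nil: "hole_stack 0 []"
  by (simp add: hole_stack_def)

lemma length_hole_stack:
  assumes "hole_stack i zs"
  shows "length zs \<le> i"
proof -
  have "length zs = card (set zs)"
    using assms by (simp add: hole_stack_def strict_sorted_iff distinct_card)
  also have "\<dots> \<le> card {..<i}"
    using assms by (intro card_mono) (auto simp: hole_stack_def)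
  finally show ?thesis by simp
qed

lemma hole_stack_push: "hole_stack i zs \<Longrightarrow> hole_stack (Suc i) (zs @ [i])"
  by (cases zs) (auto simp: hole_stack_def sorted_wrt_append)

lemma hole_stack_raise:
  assumes "hole_stack i (zs @ [z])" "zs \<noteq> []" "z \<le> z'" "z' < i"
  shows "hole_stack i (zs @ [z'])"
  using assms by (fastforce simp: hole_stack_def sorted_wrt_append)

lemma hole_stack_pop: "hole_stack i (zs @ [z]) \<Longrightarrow> zs \<noteq> [] \<Longrightarrow> hole_stack i zs"
  by (auto simp: hole_stack_def sorted_wrt_append)

lemma set_hole_stack_pop: "hole_stack i (zs @ [z]) \<Longrightarrow> set (zs @ [z]) - {z} = set zs"
  by (auto simp: hole_stack_def sorted_wrt_append)

lemma hole_stack_above: "hole_stack i (zs @ [z]) \<Longrightarrow> set (zs @ [z]) \<inter> {z<..j} = {}"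
  by (fastforce simp: hole_stack_def sorted_wrt_append)

text \<open>Moving the hole from \<open>z\<close> to \<open>i\<close> takes \<open>i - z\<close>
  chips, and one more is absorbed there.\<close>

lemma reachable_pop_stack:
  assumes "hole_stack (Suc i) (zs @ [z])" "Suc i < n"
  shows "reachable n (pile \<sigma> (Suc i) (set (zs @ [z])) (Suc e + (i - z)) c)
    (pile \<sigma> (Suc i) (set zs) e (c + (i - z)))"
proof -
  have z: "z \<le> i" and "\<forall>v\<in>set zs. v < z"
    using assms(1) by (auto simp: hole_stack_def sorted_wrt_append)
  then have "insert i (set zs) - {i} = set zs"
    by fastforce
  then show ?thesis
    using reachable_slide[of z "i - z" i n "set (zs @ [z])" \<sigma> "Suc e" c] z assms
      pile_pop[of i "insert i (set zs)" \<sigma> e "c + (i - z)"]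
    by (simp only: set_hole_stack_pop[OF assms(1)] hole_stack_above[OF assms(1)]) simp
qed

lemma reachable_raise_stack:
  assumes "hole_stack (Suc i) (zs @ [z])" "Suc i < n" "e \<le> i - z"
  shows "reachable n (pile \<sigma> (Suc i) (set (zs @ [z])) e c)
    (pile \<sigma> (Suc i) (set (zs @ [z + e])) 0 (c + e))"
proof -
  have z: "z \<le> i"
    using assms(1) by (auto simp: hole_stack_def)
  show ?thesis
    using reachable_slide[of z e i n "set (zs @ [z])" \<sigma> 0 c] z assms
    by (simp only: set_hole_stack_pop[OF assms(1)] hole_stack_above[OF assms(1)]) simp
qed

text \<open>The bound \<open>width\<close> leaves room for all addresses and for all sums that the
  program forms.\<close>

locale path_word_ram =
  fixes n w :: nat and \<sigma> :: "nat configuration"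
  assumes n_pos: "1 \<le> n"
    and width: "4 * n < 2 ^ w"
begin

text \<open>Memory layout: cell \<open>0\<close> is the flag, cell \<open>v + 1\<close> belongs to vertex \<open>v\<close>, and the
  stack of holes, whose entries are cell addresses, starts at cell \<open>n + 1\<close>.\<close>

definition stack_at :: "nat list \<Rightarrow> nat list \<Rightarrow> bool" where
  "stack_at zs M \<longleftrightarrow> (\<forall>k<length zs. M ! Suc (n + k) = Suc (zs ! k))"

definition memory :: "nat \<Rightarrow> nat list \<Rightarrow> nat list \<Rightarrow> bool" where
  "memory i zs M \<longleftrightarrow> length M = 2 * n + 1 \<and>
     (\<forall>v<n. M ! Suc v = (if v < i then 1 else \<sigma> v)) \<and> stack_at zs M"

lemma stack_at_top: "stack_at (zs @ [z]) M \<Longrightarrow> M ! Suc (n + length zs) = Suc z"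
  unfolding stack_at_def by (metis length_append_singleton lessI nth_append_length)

lemma stack_at_pop: "stack_at (zs @ [z]) M \<Longrightarrow> stack_at zs M"
  by (auto simp: stack_at_def nth_append dest: spec[of _ k for k])

lemma memory_push:
  assumes "memory i zs M" "Suc i < n" "length zs \<le> i"
  shows "memory (Suc i) (zs @ [i]) (M[Suc i := Suc 0, Suc (n + length zs) := Suc i])"
  using assms by (auto simp: memory_def stack_at_def nth_append nth_list_update)

lemma memory_raise:
  assumes "memory i (zs @ [z]) M" "length zs < n"
  shows "memory i (zs @ [z']) (M[Suc (n + length zs) := Suc z'])"
  using assms by (auto simp: memory_def stack_at_def nth_append nth_list_update)

section \<open>Loop invariants\<close>

definition registers :: "nat \<Rightarrow> nat list \<Rightarrow> (nat \<Rightarrow> nat) \<Rightarrow> bool" where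
  "registers i zs R \<longleftrightarrow> R 0 = 0 \<and> R 1 = 1 \<and> R 2 = n \<and> R 3 = n - 1 \<and> R 4 = Suc n \<and>
     R 5 = n + length zs \<and> R 6 = i \<and> R 7 = sum \<sigma> {..<i}"

text \<open>The equation counts chips: apart from \<open>e\<close> and \<open>c\<close>, the processed vertices hold
  \<open>i - length zs\<close> chips.\<close>

definition processed :: "nat \<Rightarrow> nat list \<Rightarrow> nat \<Rightarrow> nat \<Rightarrow> bool" where
  "processed i zs e c \<longleftrightarrow> hole_stack i zs \<and> i < n \<and> i + e + c = sum \<sigma> {..<i} + length zs \<and>
     reachable n \<sigma> (pile \<sigma> i (set zs) e c)"

text \<open>The bound on the chips read is not strict because it must hold initially also for
  \<open>n = 1\<close>.\<close>

definition outer_inv :: "nat \<Rightarrow> nat list \<Rightarrow> (nat \<Rightarrow> nat) \<Rightarrow> nat list \<Rightarrow> bool" where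
  "outer_inv i zs R M \<longleftrightarrow> registers i zs R \<and> memory i zs M \<and> processed i zs 0 (R 8) \<and>
     sum \<sigma> {..<i} \<le> n - 1"

definition inner_inv :: "nat \<Rightarrow> nat list \<Rightarrow> (nat \<Rightarrow> nat) \<Rightarrow> nat list \<Rightarrow> bool" where
  "inner_inv i zs R M \<longleftrightarrow> registers i zs R \<and> memory i zs M \<and> processed i zs (R 9) (R 8) \<and>
     sum \<sigma> {..<i} \<le> n - 1 \<and> 0 < i"

text \<open>Every hole carries 10 units of time, which pay for the 9 instructions that pop it. The
  additional 10 pay for the last round, and \<open>A\<close> is the remaining budget of the outer
  loop.\<close>

lemma inner_loop:
  assumes "inner_inv i zs R M"
    and cont: "\<And>zs R M. outer_inv i zs R M \<Longrightarrow>
      reaches w path_program (A + 10 * length zs) (5, R, M) Q"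
  shows "reaches w path_program (A + 10 * length zs + 10) (19, R, M) Q"
  using assms(1)
proof (induction zs arbitrary: R M rule: rev_induct)
  case Nil
  then show ?case
    by (auto simp: inner_inv_def processed_def hole_stack_def)
next
  case (snoc z zs)
  define e c where "e = R 9" and "c = R 8"
  obtain j where i: "i = Suc j"
    using snoc.prems by (auto simp: inner_inv_def gr0_conv_Suc)
  have stack: "hole_stack (Suc j) (zs @ [z])" and lt: "Suc j < n"
    and count: "Suc (j + e + c) = sum \<sigma> {..<Suc j} + Suc (length zs)"
    and reach: "reachable n \<sigma> (pile \<sigma> (Suc j) (set (zs @ [z])) e c)"
    and mem: "memory (Suc j) (zs @ [z]) M" and total: "sum \<sigma> {..<Suc j} \<le> n - 1"
    using snoc.prems i by (auto simp: inner_inv_def processed_def e_def c_def)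
  have regs: "R 0 = 0" "R 1 = 1" "R 2 = n" "R 3 = n - 1" "R 4 = Suc n"
    "R 5 = Suc (n + length zs)" "R 6 = Suc j" "R 7 = sum \<sigma> {..<Suc j}" "R 8 = c" "R 9 = e"
    using snoc.prems i by (auto simp: inner_inv_def registers_def e_def c_def)
  have len: "length zs \<le> j"
    using length_hole_stack[OF stack] by simp
  have z: "z \<le> j"
    using stack by (auto simp: hole_stack_def)
  \<comment> \<open>There are at most as many holes as processed vertices, so the count bounds
    \<open>e + c\<close> by the chips read.\<close>
  have ec: "e + c < n"
    using count len total lt by linarith
  have M_len: "length M = 2 * n + 1" and top: "M ! Suc (n + length zs) = Suc z"
    using mem stack_at_top by (auto simp: memory_def)
  have words: "Suc (Suc (n + length zs)) < 2 ^ w" "Suc (Suc j) < 2 ^ w" "e + c < 2 ^ w" "e < 2 ^ w"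
    "Suc (z + e) < 2 ^ w" "c + e < 2 ^ w" "Suc (n + length zs) < 2 ^ w" "Suc j < 2 ^ w"
    using width len lt ec z by linarith+
  \<comment> \<open>The bottom hole stays and lets everything through; a higher one is popped if the
    excess is larger than its distance to \<open>j\<close>, and raised otherwise.\<close>
  consider "zs = []" | "zs \<noteq> []" "j - z < e" | "zs \<noteq> []" "e \<le> j - z"
    by linarith
  then show ?case
  proof cases
    case 1
    then have z0: "z = 0"
      using stack by (simp add: hole_stack_def)
    obtain R' where run: "ram_run w path_program 3 (19, R, M) = Some (5, R', M)"
      and R': "registers (Suc j) [z] R'" "R' 8 = c + e"
      using regs words 1 by (simp add: exec registers_def)
    have "outer_inv i [z] R' M"
      unfolding outer_inv_def processed_def i R'(2)
    proof (intro conjI)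
      show "reachable n \<sigma> (pile \<sigma> (Suc j) (set [z]) 0 (c + e))"
        using reach 1 z0 rtranclp_trans[OF _ reachable_bounce_left[OF lt]] by simp
    qed (use R' mem stack lt count total 1 in auto)
    from cont[OF this] show ?thesis
      using reaches_run[OF run] 1 by simp
  next
    case 2
    obtain R' where run: "ram_run w path_program 9 (19, R, M) = Some (19, R', M)"
      and R': "registers (Suc j) zs R'" "R' 8 = c + (j - z)" "R' 9 = e - Suc (j - z)"
      using regs words 2 M_len len lt top z ec by (simp add: exec registers_def)
    obtain e' where e': "e = Suc e' + (j - z)"
      using 2(2) less_iff_Suc_add by auto
    have "inner_inv i zs R' M"
      unfolding inner_inv_def processed_def i R'(2,3)
    proof (intro conjI)
      show "reachable n \<sigma> (pile \<sigma> (Suc j) (set zs) (e - Suc (j - z)) (c + (j - z)))"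
        using rtranclp_trans[OF reach] reachable_pop_stack[OF stack lt, of \<sigma> e' c] e' by simp
      show "memory (Suc j) zs M"
        using mem stack_at_pop by (auto simp: memory_def)
    qed (use R' hole_stack_pop[OF stack] lt count total 2 in auto)
    from snoc.IH[OF this] show ?thesis
      by (rule reaches_run[OF run]) simp
  next
    case 3
    obtain R' where run: "ram_run w path_program 8 (19, R, M) =
        Some (5, R', M[Suc (n + length zs) := Suc (z + e)])"
      and R': "registers (Suc j) (zs @ [z + e]) R'" "R' 8 = c + e"
      using regs words 3 M_len len lt top z ec by (simp add: exec registers_def)
    have "outer_inv i (zs @ [z + e]) R' (M[Suc (n + length zs) := Suc (z + e)])"
      unfolding outer_inv_def processed_def i R'(2)
    proof (intro conjI)
      show "reachable n \<sigma> (pile \<sigma> (Suc j) (set (zs @ [z + e])) 0 (c + e))"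
        using rtranclp_trans[OF reach reachable_raise_stack[OF stack lt 3(2)]] .
      show "hole_stack (Suc j) (zs @ [z + e])"
        using hole_stack_raise[OF stack] 3 z by simp
      show "memory (Suc j) (zs @ [z + e]) (M[Suc (n + length zs) := Suc (z + e)])"
        using memory_raise[OF mem] len lt by simp
    qed (use R' lt count total in auto)
    from cont[OF this] show ?thesis
      by (rule reaches_run[OF run]) simp
  qed
qed


text \<open>The stack lies behind the vertex cells, so clearing these cells does not damage the
  entries still to be read.\<close>

lemma clear_loop:
  assumes "R 0 = 0" "R 1 = 1" "R 4 = Suc n" "R 5 = n + length zs" "zs \<noteq> []" "length zs \<le> n"
    and "length M = 2 * n + 1" "stack_at zs M" "set zs \<subseteq> {..<n}"
  shows "reaches w path_program (10 * length zs) (37, R, M) (\<lambda>(pc, R', M'). pc = 40 \<and>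
     length M' = 2 * n + 1 \<and> M' ! 0 = M ! 0 \<and>
     (\<forall>v<n. M' ! Suc v = (if v \<in> set zs then 0 else M ! Suc v)))"
  using assms
proof (induction zs arbitrary: R M rule: rev_induct)
  case Nil
  then show ?case by simp
next
  case (snoc z zs)
  define M1 where "M1 = M[Suc z := 0]"
  have top: "M ! Suc (n + length zs) = Suc z"
    using stack_at_top snoc.prems(8) .
  have z: "z < n" and len: "length zs < n"
    using snoc.prems by auto
  have words: "Suc (n + length zs) < 2 ^ w"
    using width len by linarith
  have cells: "length M1 = 2 * n + 1" "M1 ! 0 = M ! 0"
    "\<And>v. v < n \<Longrightarrow> M1 ! Suc v = (if v = z then 0 else M ! Suc v)"
    using snoc.prems(7) z by (auto simp: M1_def nth_list_update)
  show ?case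
  proof (cases "zs = []")
    case True
    obtain R' where run: "ram_run w path_program 3 (37, R, M) = Some (40, R', M1)"
      using snoc.prems(1-7) words top z True by (simp add: exec M1_def)
    show ?thesis
      by (rule reaches_run[OF run reaches_refl[where T = 0]]) (use cells True in auto)
  next
    case False
    obtain R' where run: "ram_run w path_program 5 (37, R, M) = Some (37, R', M1)"
      and R': "R' 0 = 0" "R' 1 = 1" "R' 4 = Suc n" "R' 5 = n + length zs"
      using snoc.prems(1-7) words top z False by (simp add: exec M1_def)
    have "stack_at zs M1"
      using stack_at_pop[OF snoc.prems(8)] z len snoc.prems(7)
      by (auto simp: stack_at_def M1_def nth_list_update)
    then have "reaches w path_program (10 * length zs) (37, R', M1) (\<lambda>(pc, R', M'). pc = 40 \<and>
       length M' = 2 * n + 1 \<and> M' ! 0 = M1 ! 0 \<and>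
       (\<forall>v<n. M' ! Suc v = (if v \<in> set zs then 0 else M1 ! Suc v)))"
      using R' False len cells(1) snoc.prems(9) by (intro snoc.IH) auto
    then show ?thesis
      by (rule reaches_run[OF run reaches_weaken]) (use cells in auto)
  qed
qed

definition solved :: "ram_state \<Rightarrow> bool" where
  "solved s \<longleftrightarrow> ram_halted path_program s \<and> correct_path_output n \<sigma> (snd (snd s))"

text \<open>A prefix with \<open>n - 1\<close> chips already exceeds what a terminal configuration
  can hold.\<close>

lemma solved_if_too_many_chips:
  assumes "i < n" "n - 1 \<le> sum \<sigma> {..<Suc i}" "length M = 2 * n + 1"
  shows "solved (44, R, M[0 := 0])"
proof -
  have "sum \<sigma> {..<Suc i} \<le> sum \<sigma> {..<n}"
    using assms(1) by (intro sum_mono2) auto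
  then have "\<not> sandpile_terminates (path_graph n) \<sigma>"
    using assms(2) n_pos by (intro not_terminates_path) auto
  moreover have "take 1 (M[0 := 0]) = [0]"
    using assms(3) by (cases M) auto
  ultimately show ?thesis
    by (simp add: solved_def ram_halted_def exec correct_path_output_def)
qed

text \<open>Lowering the stack pointer by the excess \<open>R 9\<close> discards exactly the holes
  that these chips fill; the rest, with the last vertex, are the holes of the terminal
  configuration.\<close>

lemma final_phase:
  assumes "registers n zs R" "memory (n - 1) zs M" "hole_stack (n - 1) zs"
    and "R 9 < length zs"
    and "reachable n \<sigma> (pile \<sigma> n (insert (n - 1) (set zs)) (R 9) 0)"
  shows "reaches w path_program (10 * length zs + 3) (34, R, M) solved"
proof -
  define k where "k = length zs - R 9"
  define ys where "ys = take k zs"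
  \<comment> \<open>Cell \<open>n\<close> belongs to the last vertex, which ends as a hole; cell 0
    is the flag.\<close>
  define M1 where "M1 = M[n := 0, 0 := Suc 0]"
  define i where "i = n - 1"
  have i: "i = n - 1" and n: "n = Suc i"
    using n_pos by (auto simp: i_def)
  have k: "0 < k" "k \<le> length zs" and zs_len: "length zs \<le> i"
    using assms(4) length_hole_stack[OF assms(3)] n by (auto simp: k_def)
  then have ys_len: "length ys = k" and ys_ne: "ys \<noteq> []"
    by (auto simp: ys_def)
  \<comment> \<open>For a single vertex the stack would be empty, but it has more than
    \<open>R 9\<close> entries.\<close>
  have i_pos: "0 < i"
    using k zs_len by linarith
  have M_len: "length M = 2 * n + 1" and cells: "v < n \<Longrightarrow> M ! Suc v = (if v < i then 1 else \<sigma> v)"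
    and st: "stack_at zs M" for v
    using assms(2) by (auto simp: memory_def i)
  then have M_ne: "M \<noteq> []"
    by auto
  have words: "n + length zs < 2 ^ w"
    using width zs_len n by linarith
  obtain R' where run: "ram_run w path_program 3 (34, R, M) = Some (37, R', M1)"
    and R': "R' 0 = 0" "R' 1 = 1" "R' 4 = Suc n" "R' 5 = n + length ys"
    using assms(1,4) M_len M_ne words by (simp add: exec M1_def registers_def ys_len k_def)
  have sub: "set ys \<subseteq> {..<i}"
    using assms(3) n set_take_subset[of k zs] by (auto simp: hole_stack_def ys_def)
  have hd_ys: "0 \<in> set ys"
    using assms(3) i_pos n ys_ne k hd_in_set[of ys] by (auto simp: hole_stack_def ys_def hd_take)
  define \<tau> where "\<tau> = pile \<sigma> n (insert i (set ys)) 0 0"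
  have "reachable n \<sigma> \<tau>"
  proof (rule rtranclp_trans[OF assms(5)])
    have "zs = ys @ drop k zs" "length (drop k zs) = R 9"
      using assms(4) by (auto simp: ys_def k_def)
    then show "reachable n (pile \<sigma> n (insert (n - 1) (set zs)) (R 9) 0) \<tau>"
      using reachable_bounce_right[of ys "drop k zs" i \<sigma>] assms(3)
      by (simp add: hole_stack_def \<tau>_def n)
  qed
  moreover have "terminal (path_graph n) \<tau>"
    unfolding \<tau>_def n using i_pos hd_ys by (intro terminal_pile) auto
  ultimately have terminates: "terminates_in (path_graph n) \<sigma> \<tau>"
    by (simp add: terminates_in_def)
  have "reaches w path_program (10 * length ys) (37, R', M1) (\<lambda>(pc, R', M'). pc = 40 \<and>
     length M' = 2 * n + 1 \<and> M' ! 0 = M1 ! 0 \<and>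
     (\<forall>v<n. M' ! Suc v = (if v \<in> set ys then 0 else M1 ! Suc v)))"
  proof (rule clear_loop[OF R' ys_ne])
    show "stack_at ys M1"
      using st k ys_len by (auto simp: stack_at_def M1_def ys_def)
  qed (use sub n M_len ys_len k zs_len in \<open>auto simp: M1_def\<close>)
  then have "reaches w path_program (10 * length ys) (37, R', M1) solved"
  proof (rule reaches_weaken, clarify)
    fix pc R'' M'
    assume M': "length M' = 2 * n + 1" "M' ! 0 = M1 ! 0"
      "\<forall>v<n. M' ! Suc v = (if v \<in> set ys then 0 else M1 ! Suc v)"
    have "take (Suc n) M' = 1 # map \<tau> [0..<n]"
    proof (rule nth_equalityI)
      fix v
      assume "v < length (take (Suc n) M')"
      then have v: "v \<le> n"
        using M' by simp
      show "take (Suc n) M' ! v = (1 # map \<tau> [0..<n]) ! v"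
      proof (cases v)
        case 0
        then show ?thesis
          using M' M_len by (simp add: M1_def)
      next
        case (Suc u)
        then have u: "u < n"
          using v by simp
        have "M1 ! Suc u = (if u = i then 0 else 1)"
          using cells[OF u] u n M_len by (auto simp: M1_def nth_list_update)
        then have "M' ! Suc u = \<tau> u"
          using M'(3) u n by (auto simp: \<tau>_def pile_def)
        then show ?thesis
          using Suc u by simp
      qed
    qed (use M' in auto)
    then show "solved (40, R'', M')"
      using terminates by (auto simp: solved_def ram_halted_def exec correct_path_output_def sandpile_terminates_def)
  qed
  then show ?thesis
    by (rule reaches_run[OF run]) (use ys_len k in simp)
qed

text \<open>The 40 units per vertex cover its own instructions, the last inner round and the 10
  units stored with the hole it pushes.\<close>

lemma outer_loop:
  assumes "outer_inv i zs R M"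
  shows "reaches w path_program (40 * (n - i) + 10 * length zs + 10) (5, R, M) solved"
  using assms
proof (induction "n - i" arbitrary: i zs R M rule: less_induct)
  case less
  define c where "c = R 8"
  have stack: "hole_stack i zs" and lt: "i < n" and count: "i + c = sum \<sigma> {..<i} + length zs"
    and reach: "reachable n \<sigma> (pile \<sigma> i (set zs) 0 c)"
    and mem: "memory i zs M" and total: "sum \<sigma> {..<i} \<le> n - 1"
    using less.prems by (auto simp: outer_inv_def processed_def c_def)
  have regs: "R 0 = 0" "R 1 = 1" "R 2 = n" "R 3 = n - 1" "R 4 = Suc n"
    "R 5 = n + length zs" "R 6 = i" "R 7 = sum \<sigma> {..<i}" "R 8 = c"
    using less.prems by (auto simp: outer_inv_def registers_def c_def)
  have len: "length zs \<le> i"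
    using length_hole_stack[OF stack] .
  have M_len: "length M = 2 * n + 1" and chips: "M ! Suc i = \<sigma> i"
    using mem lt by (auto simp: memory_def)
  then have M_ne: "M \<noteq> []"
    by auto
  have words: "Suc i < 2 ^ w" "Suc (n + length zs) < 2 ^ w" "0 < w"
    using width len lt by (linarith, linarith, cases w, auto)
  have reach': "reachable n \<sigma> (pile \<sigma> (Suc i) (insert i (set zs)) (c + \<sigma> i) 0)"
    using reach by (simp only: pile_push)
  show ?case
  \<comment> \<open>A count is compared with \<open>n - 1\<close> before it is added, so the sum
    cannot wrap around. For \<open>n = 1\<close> this test already fails.\<close>
  proof (cases "\<sigma> i < n - 1")
    case False
    obtain R' where run: "ram_run w path_program 5 (5, R, M) = Some (44, R', M[0 := 0])"
      using regs words lt M_len M_ne chips False by (simp add: exec)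
    have "solved (44, R', M[0 := 0])"
      using False lt M_len by (intro solved_if_too_many_chips[of i]) auto
    then show ?thesis
      by (rule reaches_run[OF run reaches_refl[where T = 0]]) (use lt in simp)
  next
    case small: True
    then have word_sum: "sum \<sigma> {..<i} + \<sigma> i < 2 ^ w" "c + \<sigma> i < 2 ^ w"
      using total width count len by linarith+
    show ?thesis
    proof (cases "sum \<sigma> {..<i} + \<sigma> i < n - 1")
      case False
      obtain R' where run: "ram_run w path_program 7 (5, R, M) = Some (44, R', M[0 := 0])"
        using regs words word_sum lt M_len M_ne chips small False by (simp add: exec)
      have "solved (44, R', M[0 := 0])"
        using False lt M_len by (intro solved_if_too_many_chips[of i]) auto
      then show ?thesis
        by (rule reaches_run[OF run reaches_refl[where T = 0]]) (use lt in simp)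
    next
      case True
      show ?thesis
      proof (cases "Suc i < n")
        case inner: True
        define M' where "M' = M[Suc i := Suc 0, Suc (n + length zs) := Suc i]"
        obtain R' where run: "ram_run w path_program 11 (5, R, M) = Some (19, R', M')"
          and R': "registers (Suc i) (zs @ [i]) R'" "R' 8 = 0" "R' 9 = c + \<sigma> i"
          using regs words word_sum lt M_len chips small True inner len
          by (simp add: exec registers_def M'_def)
        have "inner_inv (Suc i) (zs @ [i]) R' M'"
          unfolding inner_inv_def processed_def R'(2,3)
        proof (intro conjI)
          show "memory (Suc i) (zs @ [i]) M'"
            unfolding M'_def using mem inner len by (rule memory_push)
        qed (use R' hole_stack_push[OF stack] inner count True reach' in auto)
        then have "reaches w path_program
            ((40 * (n - Suc i) + 10) + 10 * length (zs @ [i]) + 10) (19, R', M') solved"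
        proof (rule inner_loop)
          fix zs R M
          assume "outer_inv (Suc i) zs R M"
          then have "reaches w path_program (40 * (n - Suc i) + 10 * length zs + 10) (5, R, M) solved"
            using lt by (intro less.hyps) auto
          then show "reaches w path_program (40 * (n - Suc i) + 10 + 10 * length zs) (5, R, M) solved"
            by (simp add: add_ac)
        qed
        then show ?thesis
          by (rule reaches_run[OF run]) (use lt in simp)
      next
        case last: False
        then have n: "n = Suc i"
          using lt by simp
        obtain R' where run: "ram_run w path_program 9 (5, R, M) = Some (34, R', M)"
          and R': "registers (Suc i) zs R'" "R' 9 = c + \<sigma> i"
          using regs words word_sum lt M_len chips small True last
          by (simp add: exec registers_def)
        \<comment> \<open>Here \<open>n - 1 = i\<close>, so the chip count and the bound on the
          total give \<open>c + \<sigma> i < length zs\<close>: the bottom hole survives.\<close>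
        have "reaches w path_program (10 * length zs + 3) (34, R', M) solved"
          using R' mem stack count True reach' n by (intro final_phase) auto
        then show ?thesis
          by (rule reaches_run[OF run]) (use n in simp)
      qed
    qed
  qed
qed

lemma path_program_correct:
  "\<exists>M. ram_computes w (2 * n + 1) (60 * n) path_program (path_input n \<sigma>) M \<and>
     correct_path_output n \<sigma> M"
proof (rule ram_computes_reaches)
  define M where "M = path_input n \<sigma> @ replicate (2 * n + 1 - length (path_input n \<sigma>)) 0"
  have M: "length M = 2 * n + 1" "M ! 0 = n" "M \<noteq> []"
    by (simp_all add: M_def path_input_def)
  have "memory 0 [] M"
    by (auto simp: memory_def stack_at_def M path_input_def nth_append M_def)
  moreover have "0 < w"
    using width n_pos by (cases w) auto
  then obtain R where run: "ram_run w path_program 5 (0, \<lambda>_. 0, M) = Some (5, R, M)"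
    and "registers 0 [] R" "R 8 = 0"
    using width n_pos M by (simp add: exec registers_def flip: numeral_2_eq_2)
  ultimately have "outer_inv 0 [] R M"
    using n_pos by (simp add: outer_inv_def processed_def hole_stack_Nil pile_0)
  from outer_loop[OF this]
  have "reaches w path_program (40 * n + 10) (5, R, M) solved"
    by simp
  \<comment> \<open>Initialisation takes 5 steps, and \<open>40 * n + 15 \<le> 60 * n\<close> for
    \<open>n \<ge> 1\<close>.\<close>
  then have "reaches w path_program (60 * n) (0, \<lambda>_. 0, M) solved"
    by (rule reaches_run[OF run]) (use n_pos in simp)
  then show "reaches w path_program (60 * n)
      (0, \<lambda>_. 0, path_input n \<sigma> @ replicate (2 * n + 1 - length (path_input n \<sigma>)) 0)
      (\<lambda>s. ram_halted path_program s \<and> correct_path_output n \<sigma> (snd (snd s)))"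
    by (simp add: solved_def[abs_def] M_def)
qed (simp add: path_input_def)

end

theorem theorem1p3:
  "\<exists>(P :: instr list) (K :: nat) (T :: nat \<Rightarrow> nat) (S :: nat \<Rightarrow> nat).
     1 \<le> K \<and>
     (\<lambda>n. real (T n)) \<in> O(\<lambda>n. real n) \<and>
     (\<lambda>n. real (S n)) \<in> O(\<lambda>n. real n) \<and>
     (\<forall>w :: nat \<Rightarrow> nat.
        (\<lambda>n. real (w n)) \<in> \<Theta>(\<lambda>n. ln (real n)) \<longrightarrow>
        (\<forall>n\<ge>1. K * n < 2 ^ w n) \<longrightarrow>
        (\<forall>n\<ge>1. \<forall>\<sigma> :: nat configuration.
           (\<forall>v\<in>verts (path_graph n). \<sigma> v < 2 ^ w n) \<longrightarrow>
           (\<exists>M. ram_computes (w n) (S n) (T n) P (path_input n \<sigma>) M \<and>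
                correct_path_output n \<sigma> M)))"
\<comment> \<open>The memory consists of the flag, \<open>n\<close> vertex cells and
  \<open>n\<close> cells for the stack; the factor 4 is that of \<open>width\<close>.\<close>
proof (rule exI[of _ path_program], rule exI[of _ 4], rule exI[of _ "\<lambda>n. 60 * n"],
    rule exI[of _ "\<lambda>n. 2 * n + 1"], intro conjI allI impI)
  show "(\<lambda>n. real (2 * n + 1)) \<in> O(\<lambda>n. real n)"
    by (rule bigoI[where c = 3]) (auto intro!: eventually_mono[OF eventually_ge_at_top[of 1]])
next
  fix w :: "nat \<Rightarrow> nat" and n :: nat and \<sigma> :: "nat configuration"
  assume "\<forall>n\<ge>1. 4 * n < 2 ^ w n" "1 \<le> n" "\<forall>v\<in>verts (path_graph n). \<sigma> v < 2 ^ w n"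
  then interpret path_word_ram n "w n" \<sigma>
    by unfold_locales auto
  show "\<exists>M. ram_computes (w n) (2 * n + 1) (60 * n) path_program (path_input n \<sigma>) M \<and>
      correct_path_output n \<sigma> M"
    by (rule path_program_correct)
qed auto

end
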